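(* Let $X$ be a Banach space over $\mathbb{K}$ ($\mathbb{K}=\mathbb{R}$ or $\mathbb{C}$). If $Y$ is a Banach space such that $Y^*$ is locally uniformly rotund, or if $Y=c_0$, then $\mathrm{QNA}(X,Y^* )=w^*\mathrm{QNA}(X,Y^* )$.
   Context: Banach spaces (including $c_0$) are over the same scalar field $\mathbb{K}=\mathbb{R}$ or $\mathbb{C}$; $c_0$ carries its usual sup norm and $Y^*$ its dual norm. $B_X$ and $S_X$ are the closed unit ball and unit sphere of $X$. A Banach space $Z$ is locally uniformly rotund if whenever $z\in S_Z$, $(z_n)\subset S_Z$ and $\|z_n+z\|\to 2$, then $\|z_n-z\|\to 0$. For a bounded linear operator $T\colon X\to Y^*$: $T\in\mathrm{QNA}(X,Y^* )$ if the norm closure of $T(B_X)$ intersects the sphere $\{u^*\in Y^*:\|u^*\|=\|T\|\}$; $T\in w^*\mathrm{QNA}(X,Y^* )$ if the $\sigma(Y^*,Y)$-closure of $T(B_X)$ intersects the sphere $\{u^*\in Y^*:\|u^*\|=\|T\|\}$. *)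

theory Defs
  imports "HOL-Analysis.Analysis"
begin

section \<open>The scalar field\<close>

text \<open>
  The common interface of the real and the complex field: a type of this class is isometrically
  isomorphic, as a normed field over the reals, to one of the two.
\<close>

class real_or_complex = real_normed_field + banach +
  assumes real_or_complex:
    "(\<forall>z. \<exists>a. z = a *\<^sub>R 1) \<or>
     (\<exists>i. i * i = - 1 \<and>
        (\<forall>z. \<exists>a b. z = a *\<^sub>R 1 + b *\<^sub>R i) \<and>
        (\<forall>a b. norm (a *\<^sub>R 1 + b *\<^sub>R i) = sqrt (a\<^sup>2 + b\<^sup>2)))"

instance real :: real_or_complex
  by standard auto

instance complex :: real_or_complex
proof
  have 1: "\<exists>a b. z = a *\<^sub>R 1 + b *\<^sub>R \<i>" for z
    by (intro exI[of _ "Re z"] exI[of _ "Im z"]) (simp add: complex_eq_iff)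
  have 2: "norm (a *\<^sub>R 1 + b *\<^sub>R \<i>) = sqrt (a\<^sup>2 + b\<^sup>2)" for a b
    by (simp add: cmod_def)
  show "(\<forall>z. \<exists>a. z = a *\<^sub>R (1 :: complex)) \<or>
     (\<exists>i :: complex. i * i = - 1 \<and>
        (\<forall>z. \<exists>a b. z = a *\<^sub>R 1 + b *\<^sub>R i) \<and>
        (\<forall>a b. norm (a *\<^sub>R 1 + b *\<^sub>R i) = sqrt (a\<^sup>2 + b\<^sup>2)))"
    using 1 2 by (intro disjI2 exI[of _ "\<i>"]) auto
qed


section \<open>Banach spaces over the scalar field\<close>

text \<open>
  The library's class \<open>banach\<close> only knows real scalars. A Banach space over the field \<open>'k\<close> is a
  type of that class together with a scalar multiplication by \<open>'k\<close> that extends the real one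
  and for which the norm is homogeneous.
\<close>

locale banach_space_over = vector_space scale
  for scale :: "'k::real_or_complex \<Rightarrow> 'x::banach \<Rightarrow> 'x" +
  assumes scale_of_real: "scale (of_real r) x = r *\<^sub>R x"
    and norm_scale: "norm (scale c x) = norm c * norm x"

lemma banach_space_over_real_iff:
  fixes s :: "real \<Rightarrow> 'x::banach \<Rightarrow> 'x"
  shows "banach_space_over s \<longleftrightarrow> s = (*\<^sub>R)"
proof
  assume "banach_space_over s"
  then show "s = (*\<^sub>R)"
    using banach_space_over.scale_of_real[of s] by (intro ext) simp
next
  assume "s = (*\<^sub>R)"
  then show "banach_space_over s"
    by (auto intro!: banach_space_over.intro vector_space.intro banach_space_over_axioms.intro
        simp: scaleR_add_right scaleR_add_left)
qed

lemma banach_space_over_mult: "banach_space_over ((*) :: 'k::real_or_complex \<Rightarrow> 'k \<Rightarrow> 'k)"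
  by (auto intro!: banach_space_over.intro vector_space.intro banach_space_over_axioms.intro
      simp: algebra_simps norm_mult scaleR_conv_of_real)


section \<open>The dual space and operators into it\<close>

text \<open>
  The type \<open>'y \<Rightarrow>\<^sub>L 'k\<close> consists of the bounded \<^emph>\<open>real\<close>-linear maps with the operator norm; the
  dual is the subspace of the \<open>'k\<close>-linear ones, with the same norm.
\<close>

definition dual_space :: "('k::real_or_complex \<Rightarrow> 'y::banach \<Rightarrow> 'y) \<Rightarrow> ('y \<Rightarrow>\<^sub>L 'k) set"
  where "dual_space sY = {u. Vector_Spaces.linear sY (*) (blinfun_apply u)}"

definition dual_scale :: "'k::real_or_complex \<Rightarrow> ('y::banach \<Rightarrow>\<^sub>L 'k) \<Rightarrow> ('y \<Rightarrow>\<^sub>L 'k)"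
  where "dual_scale c u = blinfun_mult_right c o\<^sub>L u"

lemma dual_scale_apply [simp]: "blinfun_apply (dual_scale c u) y = c * blinfun_apply u y"
  by (simp add: dual_scale_def)

lemma banach_space_over_dual_scale:
  "banach_space_over (dual_scale :: 'k::real_or_complex \<Rightarrow> ('y::banach \<Rightarrow>\<^sub>L 'k) \<Rightarrow> ('y \<Rightarrow>\<^sub>L 'k))"
proof (intro banach_space_over.intro vector_space.intro banach_space_over_axioms.intro)
  fix c :: 'k and u :: "'y \<Rightarrow>\<^sub>L 'k"
  have le: "norm (dual_scale c u) \<le> norm c * norm u" for c and u :: "'y \<Rightarrow>\<^sub>L 'k"
  proof (rule norm_blinfun_bound)
    show "norm (blinfun_apply (dual_scale c u) y) \<le> norm c * norm u * norm y" for y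
      using mult_left_mono[OF norm_blinfun[of u y] norm_ge_zero[of c]]
      by (simp add: norm_mult mult.assoc)
  qed simp
  show "norm (dual_scale c u) = norm c * norm u"
  proof (cases "c = 0")
    case True
    then show ?thesis using le[of c u] by simp
  next
    case False
    have "dual_scale (inverse c) (dual_scale c u) = u"
      by (rule blinfun_eqI) (simp add: False mult.assoc[symmetric])
    then have "norm u \<le> norm (inverse c) * norm (dual_scale c u)"
      using le[of "inverse c" "dual_scale c u"] by simp
    then have "norm c * norm u \<le> norm c * (norm (inverse c) * norm (dual_scale c u))"
      by (rule mult_left_mono) simp
    then have "norm c * norm u \<le> norm (dual_scale c u)"
      using False by (simp add: nonzero_norm_inverse flip: mult.assoc)
    with le[of c u] show ?thesis by simp
  qed
qed (auto intro!: blinfun_eqI simp: algebra_simps blinfun.bilinear_simps scaleR_conv_of_real)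

lemma (in banach_space_over) subspace_dual_space:
  "module.subspace dual_scale (dual_space scale)"
proof -
  interpret d: banach_space_over "dual_scale :: 'k \<Rightarrow> ('x \<Rightarrow>\<^sub>L 'k) \<Rightarrow> _"
    by (rule banach_space_over_dual_scale)
  have k: "module ((*) :: 'k \<Rightarrow> 'k \<Rightarrow> 'k)"
    by (simp add: module_def algebra_simps)
  have iff: "u \<in> dual_space scale \<longleftrightarrow> (\<forall>c y. blinfun_apply u (scale c y) = c * blinfun_apply u y)" for u
    unfolding dual_space_def linear_iff_module_hom module_hom_iff
    using module_axioms k by (auto simp: blinfun.add_right)
  show ?thesis
    unfolding d.subspace_def by (auto simp: iff blinfun.bilinear_simps algebra_simps)
qed

definition operators_into_dual ::
  "('k::real_or_complex \<Rightarrow> 'x::banach \<Rightarrow> 'x) \<Rightarrow> ('k \<Rightarrow> 'y::banach \<Rightarrow> 'y) \<Rightarrow>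
    ('x \<Rightarrow>\<^sub>L ('y \<Rightarrow>\<^sub>L 'k)) set"
  where "operators_into_dual sX sY =
    {T. range (blinfun_apply T) \<subseteq> dual_space sY \<and>
        Vector_Spaces.linear sX dual_scale (blinfun_apply T)}"

text \<open>The topology \<open>\<sigma>(Y*, Y)\<close>; \<open>euclidean\<close> on a function space is the product topology.\<close>

definition weak_star_topology ::
  "('k::real_or_complex \<Rightarrow> 'y::banach \<Rightarrow> 'y) \<Rightarrow> ('y \<Rightarrow>\<^sub>L 'k) topology"
  where "weak_star_topology sY = pullback_topology (dual_space sY) blinfun_apply euclidean"

definition QNA ::
  "('k::real_or_complex \<Rightarrow> 'x::banach \<Rightarrow> 'x) \<Rightarrow> ('k \<Rightarrow> 'y::banach \<Rightarrow> 'y) \<Rightarrow>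
    ('x \<Rightarrow>\<^sub>L ('y \<Rightarrow>\<^sub>L 'k)) set"
  where "QNA sX sY =
    {T \<in> operators_into_dual sX sY.
      closure (blinfun_apply T ` cball 0 1) \<inter> {u \<in> dual_space sY. norm u = norm T} \<noteq> {}}"

definition weak_star_QNA ::
  "('k::real_or_complex \<Rightarrow> 'x::banach \<Rightarrow> 'x) \<Rightarrow> ('k \<Rightarrow> 'y::banach \<Rightarrow> 'y) \<Rightarrow>
    ('x \<Rightarrow>\<^sub>L ('y \<Rightarrow>\<^sub>L 'k)) set"
  where "weak_star_QNA sX sY =
    {T \<in> operators_into_dual sX sY.
      (weak_star_topology sY closure_of (blinfun_apply T ` cball 0 1))
        \<inter> {u \<in> dual_space sY. norm u = norm T} \<noteq> {}}"


section \<open>Local uniform rotundity\<close>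

text \<open>Stated for a subspace \<open>Z\<close> of a normed space, so that it applies to \<^const>\<open>dual_space\<close>.\<close>

definition locally_uniformly_rotund :: "'a::real_normed_vector set \<Rightarrow> bool"
  where "locally_uniformly_rotund Z \<longleftrightarrow>
    (\<forall>z \<in> Z \<inter> sphere 0 1. \<forall>zs. (\<forall>n::nat. zs n \<in> Z \<inter> sphere 0 1) \<longrightarrow>
      (\<lambda>n. norm (zs n + z)) \<longlonglongrightarrow> 2 \<longrightarrow> (\<lambda>n. norm (zs n - z)) \<longlonglongrightarrow> 0)"


section \<open>The space of null sequences\<close>

typedef (overloaded) ('k::real_normed_vector) c0 = "{f :: nat \<Rightarrow> 'k. f \<longlonglongrightarrow> 0}"
  morphisms c0_nth Abs_c0
  by (rule exI[of _ "\<lambda>_. 0"]) simp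

setup_lifting type_definition_c0

lemma c0_eqI: "(\<And>n. c0_nth f n = c0_nth g n) \<Longrightarrow> f = g"
  by transfer auto

lemma c0_nth_tendsto: "c0_nth f \<longlonglongrightarrow> 0"
  using c0_nth[of f] by simp

instantiation c0 :: (real_normed_vector) real_normed_vector
begin

lift_definition zero_c0 :: "'a c0" is "\<lambda>_. 0" by simp

lift_definition plus_c0 :: "'a c0 \<Rightarrow> 'a c0 \<Rightarrow> 'a c0" is "\<lambda>f g n. f n + g n"
  using tendsto_add_zero by blast

lift_definition minus_c0 :: "'a c0 \<Rightarrow> 'a c0 \<Rightarrow> 'a c0" is "\<lambda>f g n. f n - g n"
  using tendsto_diff by fastforce

lift_definition uminus_c0 :: "'a c0 \<Rightarrow> 'a c0" is "\<lambda>f n. - f n"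
  using tendsto_minus by fastforce

lift_definition scaleR_c0 :: "real \<Rightarrow> 'a c0 \<Rightarrow> 'a c0" is "\<lambda>r f n. r *\<^sub>R f n"
  using tendsto_scaleR[OF tendsto_const] by fastforce

definition norm_c0 :: "'a c0 \<Rightarrow> real"
  where "norm_c0 f = (SUP n. norm (c0_nth f n))"

definition dist_c0 :: "'a c0 \<Rightarrow> 'a c0 \<Rightarrow> real"
  where "dist_c0 f g = norm (f - g)"

definition sgn_c0 :: "'a c0 \<Rightarrow> 'a c0"
  where "sgn_c0 f = inverse (norm f) *\<^sub>R f"

definition uniformity_c0 :: "('a c0 \<times> 'a c0) filter"
  where "uniformity_c0 = (INF e\<in>{0 <..}. principal {(x, y). dist x y < e})"

definition open_c0 :: "'a c0 set \<Rightarrow> bool"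
  where "open_c0 S = (\<forall>x\<in>S. \<forall>\<^sub>F (x', y) in uniformity. x' = x \<longrightarrow> y \<in> S)"

lemma bdd_above_c0: "bdd_above (range (\<lambda>n. norm (c0_nth f n)))"
  using convergent_imp_bounded[OF c0_nth_tendsto[of f]]
  unfolding bounded_iff bdd_above_def by blast

lemma norm_c0_nth_le: "norm (c0_nth f n) \<le> norm f"
  unfolding norm_c0_def by (rule cSUP_upper[OF _ bdd_above_c0]) simp

lemma norm_c0_le: "(\<And>n. norm (c0_nth f n) \<le> B) \<Longrightarrow> norm f \<le> B"
  unfolding norm_c0_def by (rule cSUP_least) auto

instance
proof
  fix f g h :: "'a c0" and a b :: real
  show "f + g + h = f + (g + h)" "f + g = g + f" "0 + f = f" "- f + f = 0" "f - g = f + - g"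
    "a *\<^sub>R (f + g) = a *\<^sub>R f + a *\<^sub>R g" "(a + b) *\<^sub>R f = a *\<^sub>R f + b *\<^sub>R f"
    "a *\<^sub>R b *\<^sub>R f = (a * b) *\<^sub>R f" "1 *\<^sub>R f = f"
    by (transfer; auto simp: algebra_simps)+
  show "dist f g = norm (f - g)" by (rule dist_c0_def)
  show "sgn f = inverse (norm f) *\<^sub>R f" by (rule sgn_c0_def)
  show "uniformity = (INF e\<in>{0 <..}. principal {(x :: 'a c0, y). dist x y < e})"
    by (rule uniformity_c0_def)
  show "open S = (\<forall>x\<in>S. \<forall>\<^sub>F (x', y) in uniformity. x' = x \<longrightarrow> y \<in> S)" for S :: "'a c0 set"
    by (rule open_c0_def)
  show "norm f = 0 \<longleftrightarrow> f = 0"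
  proof
    assume "norm f = 0"
    then have "c0_nth f n = 0" for n using norm_c0_nth_le[of f n] by simp
    then show "f = 0" by (intro c0_eqI) (simp add: zero_c0.rep_eq)
  qed (simp add: norm_c0_def zero_c0.rep_eq)
  show "norm (f + g) \<le> norm f + norm g"
  proof (rule norm_c0_le)
    fix n
    show "norm (c0_nth (f + g) n) \<le> norm f + norm g"
      using norm_triangle_ineq[of "c0_nth f n" "c0_nth g n"] norm_c0_nth_le[of f n]
        norm_c0_nth_le[of g n] by (simp add: plus_c0.rep_eq)
  qed
  have le: "norm (a *\<^sub>R f) \<le> \<bar>a\<bar> * norm f" for a and f :: "'a c0"
    by (rule norm_c0_le) (simp add: scaleR_c0.rep_eq mult_left_mono norm_c0_nth_le)
  show "norm (a *\<^sub>R f) = \<bar>a\<bar> * norm f"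
  proof (rule antisym[OF le])
    show "\<bar>a\<bar> * norm f \<le> norm (a *\<^sub>R f)"
    proof (cases "a = 0")
      case True
      have "0 \<le> norm (c0_nth (a *\<^sub>R f) 0)" by simp
      also have "\<dots> \<le> norm (a *\<^sub>R f)" by (rule norm_c0_nth_le)
      finally show ?thesis using True by simp
    next
      case False
      have "inverse a *\<^sub>R a *\<^sub>R f = f"
        using False by (intro c0_eqI) (simp add: scaleR_c0.rep_eq)
      then have "norm f \<le> \<bar>inverse a\<bar> * norm (a *\<^sub>R f)"
        using le[of "inverse a" "a *\<^sub>R f"] by simp
      then show ?thesis using False by (simp add: field_simps)
    qed
  qed
qed

end

instance c0 :: (banach) banach
proof
  fix X :: "nat \<Rightarrow> 'a c0"
  assume X: "Cauchy X"
  have dist_nth: "norm (c0_nth f n - c0_nth g n) \<le> norm (f - g)" for f g :: "'a c0" and n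
    using norm_c0_nth_le[of "f - g" n] by (simp add: minus_c0.rep_eq)
  have "Cauchy (\<lambda>m. c0_nth (X m) n)" for n
  proof (rule CauchyI)
    fix e :: real assume "0 < e"
    from CauchyD[OF X this] show "\<exists>M. \<forall>m\<ge>M. \<forall>k\<ge>M. norm (c0_nth (X m) n - c0_nth (X k) n) < e"
      using dist_nth le_less_trans by blast
  qed
  then have "\<exists>l. (\<lambda>m. c0_nth (X m) n) \<longlonglongrightarrow> l" for n
    by (simp add: Cauchy_convergent_iff convergent_def)
  then obtain g where g: "\<And>n. (\<lambda>m. c0_nth (X m) n) \<longlonglongrightarrow> g n" by metis
  have unif: "\<exists>M. \<forall>m\<ge>M. \<forall>n. norm (c0_nth (X m) n - g n) \<le> e" if "0 < e" for e
  proof -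
    obtain M where M: "\<And>m k. m \<ge> M \<Longrightarrow> k \<ge> M \<Longrightarrow> norm (X m - X k) < e"
      using CauchyD[OF X \<open>0 < e\<close>] by blast
    have "norm (c0_nth (X m) n - g n) \<le> e" if "m \<ge> M" for m n
    proof (rule tendsto_upperbound)
      show "(\<lambda>k. norm (c0_nth (X m) n - c0_nth (X k) n)) \<longlonglongrightarrow> norm (c0_nth (X m) n - g n)"
        by (intro tendsto_intros g)
      show "\<forall>\<^sub>F k in sequentially. norm (c0_nth (X m) n - c0_nth (X k) n) \<le> e"
        using M[OF that] dist_nth[of "X m" n] unfolding eventually_sequentially
        by (meson less_imp_le order_trans)
    qed simp
    then show ?thesis by blast
  qed
  have "g \<longlonglongrightarrow> 0"
  proof (rule LIMSEQ_I)
    fix e :: real assume "0 < e"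
    then obtain M where M: "\<And>n. norm (c0_nth (X M) n - g n) \<le> e / 2"
      using unif[of "e / 2"] by auto
    obtain N where N: "\<And>n. n \<ge> N \<Longrightarrow> norm (c0_nth (X M) n) < e / 2"
      using LIMSEQ_D[OF c0_nth_tendsto[of "X M"], of "e / 2"] \<open>0 < e\<close> by auto
    have "norm (g n - 0) < e" if "n \<ge> N" for n
      using norm_triangle_ineq4[of "c0_nth (X M) n" "c0_nth (X M) n - g n"] M[of n] N[OF that]
      by simp
    then show "\<exists>N. \<forall>n\<ge>N. norm (g n - 0) < e" by blast
  qed
  then have nth: "c0_nth (Abs_c0 g) = g" by (simp add: Abs_c0_inverse)
  have "X \<longlonglongrightarrow> Abs_c0 g"
  proof (rule LIMSEQ_I)
    fix e :: real assume "0 < e"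
    then obtain M where M: "\<And>m n. m \<ge> M \<Longrightarrow> norm (c0_nth (X m) n - g n) \<le> e / 2"
      using unif[of "e / 2"] by auto
    have "norm (X m - Abs_c0 g) \<le> e / 2" if "m \<ge> M" for m
      using M[OF that] by (intro norm_c0_le) (simp only: minus_c0.rep_eq nth)
    then show "\<exists>M. \<forall>m\<ge>M. norm (X m - Abs_c0 g) < e"
      using \<open>0 < e\<close> by (intro exI[of _ M]) fastforce
  qed
  then show "convergent X" by (auto simp: convergent_def)
qed

lift_definition c0_scale :: "'k::real_or_complex \<Rightarrow> 'k c0 \<Rightarrow> 'k c0" is "\<lambda>c f n. c * f n"
  by (simp add: tendsto_mult_right_zero)

lemma banach_space_over_c0_scale:
  "banach_space_over (c0_scale :: 'k::real_or_complex \<Rightarrow> 'k c0 \<Rightarrow> 'k c0)"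
proof (intro banach_space_over.intro vector_space.intro banach_space_over_axioms.intro)
  fix c :: 'k and f :: "'k c0"
  have le: "norm (c0_scale c f) \<le> norm c * norm f" for c and f :: "'k c0"
    by (rule norm_c0_le) (simp add: c0_scale.rep_eq norm_mult mult_left_mono norm_c0_nth_le)
  show "norm (c0_scale c f) = norm c * norm f"
  proof (cases "c = 0")
    case True
    then show ?thesis using le[of c f] by simp
  next
    case False
    have "c0_scale (inverse c) (c0_scale c f) = f"
      by (rule c0_eqI) (simp add: c0_scale.rep_eq False mult.assoc[symmetric])
    then have "norm f \<le> norm (inverse c) * norm (c0_scale c f)"
      using le[of "inverse c" "c0_scale c f"] by simp
    then have "norm c * norm f \<le> norm c * (norm (inverse c) * norm (c0_scale c f))"
      by (rule mult_left_mono) simp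
    then have "norm c * norm f \<le> norm (c0_scale c f)"
      using False by (simp add: nonzero_norm_inverse flip: mult.assoc)
    with le[of c f] show ?thesis by simp
  qed
qed (transfer; auto simp: algebra_simps scaleR_conv_of_real)+

end

theory Submission
  imports Defs
begin

text \<open>
  In both cases the dual ball has the following property: if \<open>u\<close> lies in the weak-star closure of a
  set \<open>A\<close> of functionals of norm at most \<open>norm u\<close>, then \<open>u\<close> lies in the norm closure of \<open>A\<close>.
  If the dual is locally uniformly rotund, choose \<open>y\<close> in the unit ball almost norming \<open>u\<close>; every
  \<open>v \<in> A\<close> with \<open>v y\<close> close to \<open>u y\<close> has \<open>norm (v + u)\<close> close to \<open>2 * norm u\<close>. For
  \<open>c\<^sub>0\<close>, choose \<open>y\<close> moreover with finite support \<open>{..<N}\<close>; if \<open>v \<in> A\<close> is close to \<open>u\<close> on the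
  first \<open>N\<close> unit vectors, then \<open>y\<close> almost norms both, which leaves little mass for the tails of
  \<open>u\<close> and \<open>v\<close>.
\<close>

section \<open>Weak-star closures and the reduction to a property of the dual\<close>

lemma topspace_weak_star_topology: "topspace (weak_star_topology sY) = dual_space sY"
  by (simp add: weak_star_topology_def topspace_pullback_topology)

lemma weak_star_closure_subset_dual_space: "weak_star_topology sY closure_of A \<subseteq> dual_space sY"
  using closure_of_subset_topspace[of "weak_star_topology sY" A]
  by (simp add: topspace_weak_star_topology)

text \<open>The functions within \<open>e\<close> of \<open>u\<close> at the finitely many points of
  \<open>F\<close> form an open set of the product topology, so its preimage is a weak-star
  neighbourhood of \<open>u\<close> and meets \<open>A\<close>.\<close>

lemma weak_star_closure_approx:
  assumes "u \<in> weak_star_topology sY closure_of A" "finite F" "0 < e"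
  obtains v where "v \<in> A" "\<And>y. y \<in> F \<Longrightarrow> norm (blinfun_apply v y - blinfun_apply u y) < e"
proof -
  define U where "U = (\<Inter>y\<in>F. (\<lambda>f. f y) -` ball (blinfun_apply u y) e)"
  have "open U"
    unfolding U_def
    by (intro open_INT assms(2) ballI open_vimage continuous_on_product_coordinates open_ball)
  then have "openin (weak_star_topology sY) (blinfun_apply -` U \<inter> dual_space sY)"
    unfolding weak_star_topology_def openin_pullback_topology by auto
  moreover have "u \<in> blinfun_apply -` U \<inter> dual_space sY"
    using assms(3) weak_star_closure_subset_dual_space assms(1) by (auto simp: U_def)
  ultimately have "\<exists>v. v \<in> A \<and> v \<in> blinfun_apply -` U \<inter> dual_space sY"
    by (rule assms(1)[unfolded in_closure_of, THEN conjunct2, rule_format, OF conjI, rotated])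
  then obtain v where v: "v \<in> A" "blinfun_apply v \<in> U"
    by blast
  show thesis
  proof (rule that[OF v(1)])
    fix y assume "y \<in> F"
    then have "blinfun_apply v y \<in> ball (blinfun_apply u y) e"
      using v(2) by (simp add: U_def)
    then show "norm (blinfun_apply v y - blinfun_apply u y) < e"
      by (simp add: dist_norm norm_minus_commute)
  qed
qed

text \<open>Evaluations are norm continuous, so every weak-star neighbourhood contains the trace of
  a norm-open set on the dual.\<close>

lemma closure_subset_weak_star_closure:
  assumes "u \<in> closure A" "u \<in> dual_space sY" "A \<subseteq> dual_space sY"
  shows "u \<in> weak_star_topology sY closure_of A"
  unfolding in_closure_of
proof (intro conjI allI impI)
  show "u \<in> topspace (weak_star_topology sY)"
    using assms(2) by (simp add: topspace_weak_star_topology)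
next
  fix V assume V: "u \<in> V \<and> openin (weak_star_topology sY) V"
  then obtain U where U: "open U" "V = blinfun_apply -` U \<inter> dual_space sY"
    unfolding weak_star_topology_def openin_pullback_topology by auto
  have "open (blinfun_apply -` U)"
    by (intro open_vimage[OF U(1)] continuous_on_coordinatewise_then_product continuous_intros)
  moreover have "u \<in> blinfun_apply -` U \<inter> closure A"
    using assms(1) V U(2) by auto
  ultimately have "blinfun_apply -` U \<inter> A \<noteq> {}"
    using open_Int_closure_eq_empty[of "blinfun_apply -` U" A] by auto
  then show "\<exists>y. y \<in> A \<and> y \<in> V"
    using U(2) assms(3) by auto
qed

text \<open>Take for \<open>A\<close> the image of the unit ball under \<open>T\<close>. Since only
  points with \<open>norm u = norm T\<close> count, \<open>A\<close> lies in the ball of radius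
  \<open>norm u\<close>, and the two closures have the same intersection with that sphere.\<close>

lemma QNA_eq_weak_star_QNA:
  assumes "\<And>A u. A \<subseteq> dual_space sY \<Longrightarrow> A \<subseteq> cball 0 (norm u) \<Longrightarrow>
    u \<in> weak_star_topology sY closure_of A \<Longrightarrow> u \<in> closure A"
  shows "QNA sX sY = weak_star_QNA sX sY"
proof -
  have "closure (blinfun_apply T ` cball 0 1) \<inter> {u \<in> dual_space sY. norm u = norm T} =
    (weak_star_topology sY closure_of (blinfun_apply T ` cball 0 1))
      \<inter> {u \<in> dual_space sY. norm u = norm T}"
    if "T \<in> operators_into_dual sX sY" for T
  proof -
    have sub: "blinfun_apply T ` cball 0 1 \<subseteq> dual_space sY"
      using that by (auto simp: operators_into_dual_def)
    have "norm (blinfun_apply T x) \<le> norm T" if "norm x \<le> 1" for x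
      using norm_blinfun[of T x] mult_left_mono[OF that norm_ge_zero[of T]] by simp
    then have bd: "blinfun_apply T ` cball 0 1 \<subseteq> cball 0 (norm T)"
      by auto
    show ?thesis
      using closure_subset_weak_star_closure[OF _ _ sub] assms[OF sub] bd by auto
  qed
  then show ?thesis
    unfolding QNA_def weak_star_QNA_def by (intro Collect_cong conj_cong) auto
qed

section \<open>Almost norming vectors\<close>

lemma norm_blinfun_almost_attained:
  fixes u :: "'a::real_normed_vector \<Rightarrow>\<^sub>L 'b::real_normed_vector"
  assumes "0 < e"
  obtains y where "norm y \<le> 1" "norm u - e < norm (blinfun_apply u y)"
proof -
  have "\<exists>y. norm y \<le> 1 \<and> norm u - e < norm (blinfun_apply u y)"
  proof (rule ccontr)
    assume "\<not> ?thesis"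
    then have le: "norm (blinfun_apply u y) \<le> norm u - e" if "norm y \<le> 1" for y
      using that by force
    \<comment> \<open>By homogeneity, the bound on the unit ball becomes an operator bound; the
      vector 0 shows that the bound is nonnegative.\<close>
    have "norm u \<le> norm u - e"
    proof (rule norm_blinfun_bound)
      show "0 \<le> norm u - e" using le[of 0] by simp
      show "norm (blinfun_apply u y) \<le> (norm u - e) * norm y" for y
      proof (cases "y = 0")
        case False
        then show ?thesis
          using le[of "inverse (norm y) *\<^sub>R y"] by (simp add: blinfun.scaleR_right field_simps)
      qed simp
    qed
    with assms show False by simp
  qed
  with that show thesis by blast
qed

lemma norm_blinfun_le_unit_ball:
  fixes u :: "'a::real_normed_vector \<Rightarrow>\<^sub>L 'b::real_normed_vector"
  assumes "\<And>y. norm y \<le> 1 \<Longrightarrow> norm (blinfun_apply u y) \<le> b"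
  shows "norm u \<le> b"
proof (rule field_le_epsilon)
  fix e :: real assume "0 < e"
  then obtain y where "norm y \<le> 1" "norm u - e < norm (blinfun_apply u y)"
    by (rule norm_blinfun_almost_attained)
  then show "norm u \<le> b + e" using assms[of y] by simp
qed

section \<open>Locally uniformly rotund duals\<close>

lemma (in banach_space_over) scaleR_dual_space:
  assumes "u \<in> dual_space scale"
  shows "r *\<^sub>R u \<in> dual_space scale"
proof -
  interpret d: banach_space_over "dual_scale :: 'k \<Rightarrow> ('x \<Rightarrow>\<^sub>L 'k) \<Rightarrow> _"
    by (rule banach_space_over_dual_scale)
  have "dual_scale (of_real r) u \<in> dual_space scale"
    using d.subspace_scale[OF subspace_dual_space assms] .
  then show ?thesis by (simp add: d.scale_of_real)
qed

text \<open>Carries rotundity from the unit sphere to vectors that are merely bounded by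
  \<open>norm u\<close>: the norms of \<open>v n\<close> are forced to converge, so rotundity can be
  applied to the normalised vectors and the result scaled back.\<close>

lemma tendsto_if_norm_add_tendsto:
  fixes v :: "nat \<Rightarrow> 'a::real_normed_vector"
  assumes lur: "locally_uniformly_rotund Z"
    and Z: "\<And>x r. x \<in> Z \<Longrightarrow> r *\<^sub>R x \<in> Z" "u \<in> Z" "\<And>n. v n \<in> Z"
    and nz: "u \<noteq> 0" "\<And>n. v n \<noteq> 0"
    and le: "\<And>n. norm (v n) \<le> norm u"
    and lim: "(\<lambda>n. norm (v n + u)) \<longlonglongrightarrow> 2 * norm u"
  shows "v \<longlonglongrightarrow> u"
proof -
  have nu: "0 < norm u" using nz by simp
  have nv: "(\<lambda>n. norm (v n)) \<longlonglongrightarrow> norm u"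
  proof (rule tendsto_sandwich)
    show "(\<lambda>n. norm (v n + u) - norm u) \<longlonglongrightarrow> norm u"
      using tendsto_diff[OF lim tendsto_const[of "norm u"]] by simp
    show "\<forall>\<^sub>F n in sequentially. norm (v n + u) - norm u \<le> norm (v n)"
      using norm_triangle_ineq[of "v _" u] by (simp add: diff_le_eq)
  qed (use le in auto)
  have sgn_ge: "norm (v n + u) / norm u - (1 - norm (v n) / norm u) \<le> norm (sgn (v n) + sgn u)" for n
  proof -
    \<comment> \<open>Replacing \<open>v n\<close> by its normalisation costs exactly the defect
      \<open>1 - norm (v n) / norm u\<close>, which tends to 0.\<close>
    have eq: "(v n + u) /\<^sub>R norm u = (sgn (v n) + sgn u) - (1 - norm (v n) / norm u) *\<^sub>R sgn (v n)"
      using nz by (simp add: sgn_div_norm algebra_simps divide_inverse)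
    have "norm (v n + u) / norm u = norm ((v n + u) /\<^sub>R norm u)"
      by (simp add: divide_inverse mult.commute)
    also have "\<dots> \<le> norm (sgn (v n) + sgn u) + norm ((1 - norm (v n) / norm u) *\<^sub>R sgn (v n))"
      unfolding eq by (rule norm_triangle_ineq4)
    also have "norm ((1 - norm (v n) / norm u) *\<^sub>R sgn (v n)) = 1 - norm (v n) / norm u"
      using nz le[of n] by (simp add: norm_sgn)
    finally show ?thesis by simp
  qed
  have "(\<lambda>n. norm (sgn (v n) + sgn u)) \<longlonglongrightarrow> 2"
  proof (rule tendsto_sandwich)
    have "(\<lambda>n. norm (v n + u) / norm u - (1 - norm (v n) / norm u))
        \<longlonglongrightarrow> 2 * norm u / norm u - (1 - norm u / norm u)"
      using nz by (intro tendsto_intros lim nv) auto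
    then show "(\<lambda>n. norm (v n + u) / norm u - (1 - norm (v n) / norm u)) \<longlonglongrightarrow> 2"
      using nz by simp
    show "\<forall>\<^sub>F n in sequentially. norm (sgn (v n) + sgn u) \<le> 2"
    proof (intro always_eventually allI)
      fix n
      show "norm (sgn (v n) + sgn u) \<le> 2"
        using norm_triangle_ineq[of "sgn (v n)" "sgn u"] nz by (simp add: norm_sgn)
    qed
  qed (use sgn_ge in auto)
  moreover have "sgn u \<in> Z \<inter> sphere 0 1" "\<forall>n. sgn (v n) \<in> Z \<inter> sphere 0 1"
    using Z nz by (auto simp: sgn_div_norm)
  ultimately have "(\<lambda>n. norm (sgn (v n) - sgn u)) \<longlonglongrightarrow> 0"
    using lur[unfolded locally_uniformly_rotund_def, rule_format, of "sgn u" "\<lambda>n. sgn (v n)"]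
    by blast
  then have "(\<lambda>n. sgn (v n)) \<longlonglongrightarrow> sgn u"
    by (simp add: LIM_zero_iff tendsto_norm_zero_iff)
  from tendsto_scaleR[OF nv this] show ?thesis
    using nz by (simp add: sgn_div_norm)
qed

lemma (in banach_space_over) weak_star_closure_imp_closure_rotund:
  assumes lur: "locally_uniformly_rotund (dual_space scale)"
    and A: "A \<subseteq> dual_space scale" "A \<subseteq> cball 0 (norm u)"
    and u: "u \<in> weak_star_topology scale closure_of A"
  shows "u \<in> closure A"
proof (cases "u = 0")
  case True
  obtain v where "v \<in> A"
    using weak_star_closure_approx[OF u, of "{}" 1] by auto
  moreover have "v = u" using True A(2) \<open>v \<in> A\<close> by auto
  ultimately show ?thesis using closure_subset by blast
next
  case False
  \<comment> \<open>The factor 1/4 ensures \<open>3 * e n < norm u\<close>. The lower bound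
    \<open>2 * norm u - 3 * e n\<close> for \<open>norm (v n + u)\<close> then exceeds
    \<open>norm u\<close>, which excludes \<open>v n = 0\<close>.\<close>
  define e where "e n = norm u / 4 * inverse (real (Suc n))" for n
  have e: "0 < e n" "3 * e n < norm u" for n
  proof -
    show "0 < e n" using False by (simp add: e_def)
    have "inverse (real (Suc n)) \<le> 1" by (simp add: inverse_le_1_iff)
    then have "e n \<le> norm u / 4"
      unfolding e_def by (intro mult_left_le) auto
    moreover have "0 < norm u" using False by simp
    ultimately show "3 * e n < norm u" by linarith
  qed
  have "e \<longlonglongrightarrow> 0"
    unfolding e_def by (intro tendsto_mult_right_zero LIMSEQ_inverse_real_of_nat)
  \<comment> \<open>Two of the three errors come from doubling the norming defect of
    \<open>y\<close>, the third from the distance of \<open>v y\<close> to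
    \<open>u y\<close>.\<close>
  have "\<exists>v\<in>A. 2 * norm u - 3 * e n \<le> norm (v + u)" for n
  proof -
    obtain y where y: "norm y \<le> 1" "norm u - e n < norm (blinfun_apply u y)"
      using norm_blinfun_almost_attained[OF e(1)] .
    obtain v where v: "v \<in> A" "norm (blinfun_apply v y - blinfun_apply u y) < e n"
      using weak_star_closure_approx[OF u, of "{y}" "e n"] e(1) by auto
    have "2 * norm (blinfun_apply u y) = norm (2 *\<^sub>R blinfun_apply u y)"
      by simp
    also have "2 *\<^sub>R blinfun_apply u y
        = blinfun_apply (v + u) y - (blinfun_apply v y - blinfun_apply u y)"
      by (simp add: blinfun.add_left scaleR_2)
    also have "norm \<dots> \<le> norm (blinfun_apply (v + u) y) + e n"
      using norm_triangle_ineq4 v(2) by (smt (verit))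
    also have "norm (blinfun_apply (v + u) y) \<le> norm (v + u)"
      using norm_blinfun[of "v + u" y] mult_left_mono[OF y(1) norm_ge_zero[of "v + u"]] by simp
    finally show ?thesis using y(2) v(1) by (intro bexI[of _ v]) auto
  qed
  then obtain v where v: "\<And>n. v n \<in> A" "\<And>n. 2 * norm u - 3 * e n \<le> norm (v n + u)"
    by metis
  have le: "norm (v n) \<le> norm u" for n using v(1)[of n] A(2) by auto
  have sum_le: "norm (v n + u) \<le> 2 * norm u" for n
    using norm_triangle_ineq[of "v n" u] le[of n] by simp
  have "(\<lambda>n. norm (v n + u)) \<longlonglongrightarrow> 2 * norm u"
  proof (rule tendsto_sandwich)
    show "(\<lambda>n. 2 * norm u - 3 * e n) \<longlonglongrightarrow> 2 * norm u"
      using tendsto_diff[OF tendsto_const tendsto_mult_right_zero[OF \<open>e \<longlonglongrightarrow> 0\<close>]] by simp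
  qed (use v sum_le in auto)
  moreover have "v n \<noteq> 0" for n
    using v(2)[of n] e(2)[of n] by auto
  moreover have "u \<in> dual_space scale"
    using u weak_star_closure_subset_dual_space by blast
  ultimately have "v \<longlonglongrightarrow> u"
    using tendsto_if_norm_add_tendsto[OF lur scaleR_dual_space] v(1) A(1) le False by blast
  then show ?thesis
    using v(1) closure_sequential by blast
qed

section \<open>Truncation and functionals on c_0\<close>

lift_definition c0_unit :: "nat \<Rightarrow> 'k::real_or_complex c0" is "\<lambda>i n. if n = i then 1 else 0"
proof -
  fix i
  have "\<forall>\<^sub>F n in sequentially. (if n = i then 1 else 0) = (0::'k)"
    unfolding eventually_sequentially by (intro exI[of _ "Suc i"]) auto
  then show "(\<lambda>n. if n = i then 1 else 0) \<longlonglongrightarrow> (0::'k)"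
    by (rule tendsto_eventually)
qed

text \<open>The form as a sum of unit vectors lets a functional be applied term by term.\<close>

definition c0_truncate :: "nat \<Rightarrow> 'k::real_or_complex c0 \<Rightarrow> 'k c0"
  where "c0_truncate N f = (\<Sum>i<N. c0_scale (c0_nth f i) (c0_unit i))"

lemma c0_nth_sum: "c0_nth (sum f A) n = (\<Sum>i\<in>A. c0_nth (f i) n)"
  by (induction A rule: infinite_finite_induct) (auto simp: zero_c0.rep_eq plus_c0.rep_eq)

lemma c0_nth_truncate: "c0_nth (c0_truncate N f) n = (if n < N then c0_nth f n else 0)"
  by (simp add: c0_truncate_def c0_nth_sum c0_scale.rep_eq c0_unit.rep_eq if_distrib cong: if_cong)

lemma c0_truncate_tendsto: "(\<lambda>N. c0_truncate N f) \<longlonglongrightarrow> f"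
proof (rule LIMSEQ_I)
  fix e :: real assume "0 < e"
  then obtain N where N: "\<And>n. n \<ge> N \<Longrightarrow> norm (c0_nth f n) < e / 2"
    using LIMSEQ_D[OF c0_nth_tendsto[of f], of "e / 2"] by auto
  have "norm (c0_truncate M f - f) \<le> e / 2" if "M \<ge> N" for M
    using N that \<open>0 < e\<close>
    by (intro norm_c0_le) (auto simp: minus_c0.rep_eq c0_nth_truncate intro: less_imp_le)
  then show "\<exists>N. \<forall>M\<ge>N. norm (c0_truncate M f - f) < e"
    using \<open>0 < e\<close> by (intro exI[of _ N]) fastforce
qed

lemma dual_space_apply_scale:
  "u \<in> dual_space sY \<Longrightarrow> blinfun_apply u (sY c y) = c * blinfun_apply u y"
  by (simp add: dual_space_def linear_iff_module_hom module_hom.scale)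

text \<open>For nonzero \<open>a\<close> and \<open>b\<close>, the unimodular \<open>c\<close> turns
  \<open>b\<close> into the direction of \<open>a\<close>, so that no cancellation occurs.\<close>

lemma rotate_to_add_norms:
  fixes a b :: "'k::real_normed_field"
  obtains c where "norm c = 1" "norm (a + c * b) = norm a + norm b"
proof (cases "a = 0 \<or> b = 0")
  case True
  then show thesis by (intro that[of 1]) auto
next
  case False
  define c where "c = (norm b / norm a) *\<^sub>R (a / b)"
  have "a + c * b = (1 + norm b / norm a) *\<^sub>R a"
    using False by (simp add: c_def scaleR_add_left)
  then have "norm (a + c * b) = (1 + norm b / norm a) * norm a"
    by simp
  also have "\<dots> = norm a + norm b"
    using False by (simp add: field_simps)
  finally show thesis
    using False by (intro that[of c]) (auto simp: c_def norm_divide)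
qed

text \<open>This is the additivity of the l_1 norm over disjoint supports: the head of
  \<open>y\<close> plus a rotated tail of \<open>g\<close> still has sup norm at most 1, and the
  rotation makes the two values of \<open>u\<close> add up in modulus.\<close>

lemma c0_dual_disjoint_support:
  assumes u: "u \<in> dual_space c0_scale"
    and y: "norm y \<le> 1" and g: "norm g \<le> 1"
  shows "norm (blinfun_apply u (c0_truncate N y)) + norm (blinfun_apply u (g - c0_truncate N g))
    \<le> norm u"
proof -
  obtain c where c: "norm c = 1"
    "norm (blinfun_apply u (c0_truncate N y) + c * blinfun_apply u (g - c0_truncate N g))
      = norm (blinfun_apply u (c0_truncate N y)) + norm (blinfun_apply u (g - c0_truncate N g))"
    by (rule rotate_to_add_norms)
  let ?f = "c0_truncate N y + c0_scale c (g - c0_truncate N g)"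
  have "norm (c0_nth y n) \<le> 1" "norm (c0_nth g n) \<le> 1" for n
    using norm_c0_nth_le[of y n] norm_c0_nth_le[of g n] y g by auto
  then have "norm ?f \<le> 1"
    using c(1)
    by (intro norm_c0_le)
      (simp add: plus_c0.rep_eq minus_c0.rep_eq c0_scale.rep_eq c0_nth_truncate norm_mult)
  then have "norm (blinfun_apply u ?f) \<le> norm u"
    using norm_blinfun[of u ?f] mult_left_mono[of "norm ?f" 1 "norm u"] by simp
  then show ?thesis
    using c(2) by (simp add: blinfun.add_right dual_space_apply_scale[OF u])
qed

text \<open>Turns control on finitely many unit vectors, all that weak-star closeness offers, into a
  bound uniform over the unit ball.\<close>

lemma c0_truncate_apply_le:
  assumes u: "u \<in> dual_space c0_scale" and "norm g \<le> 1"
    and le: "\<And>i. i < N \<Longrightarrow> norm (blinfun_apply u (c0_unit i)) \<le> d"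
  shows "norm (blinfun_apply u (c0_truncate N g)) \<le> real N * d"
proof -
  have "norm (blinfun_apply u (c0_truncate N g))
      = norm (\<Sum>i<N. c0_nth g i * blinfun_apply u (c0_unit i))"
    by (simp add: c0_truncate_def blinfun.sum_right dual_space_apply_scale[OF u])
  also have "\<dots> \<le> (\<Sum>i<N. d)"
  proof (rule sum_norm_le)
    fix i assume "i \<in> {..<N}"
    then have "norm (c0_nth g i) * norm (blinfun_apply u (c0_unit i)) \<le> 1 * d"
      using le[of i] norm_c0_nth_le[of g i] assms(2) by (intro mult_mono) auto
    then show "norm (c0_nth g i * blinfun_apply u (c0_unit i)) \<le> d"
      by (simp add: norm_mult)
  qed
  finally show ?thesis by simp
qed

lemma weak_star_closure_imp_closure_c0:
  fixes u :: "'k::real_or_complex c0 \<Rightarrow>\<^sub>L 'k"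
  assumes A: "A \<subseteq> dual_space c0_scale" "A \<subseteq> cball 0 (norm u)"
    and u: "u \<in> weak_star_topology c0_scale closure_of A"
  shows "u \<in> closure A"
  unfolding closure_approachable
proof (intro allI impI)
  interpret banach_space_over "c0_scale :: 'k \<Rightarrow> 'k c0 \<Rightarrow> _"
    by (rule banach_space_over_c0_scale)
  interpret d: banach_space_over "dual_scale :: 'k \<Rightarrow> ('k c0 \<Rightarrow>\<^sub>L 'k) \<Rightarrow> _"
    by (rule banach_space_over_dual_scale)
  fix e :: real assume "0 < e"
  \<comment> \<open>The final estimate is \<open>4 * d\<close>: one \<open>d\<close> for the head,
    one for the tail of \<open>u\<close>, two for the tail of \<open>v\<close>. A fifth makes it
    strict.\<close>
  define d where "d = e / 5"
  have "0 < d" using \<open>0 < e\<close> by (simp add: d_def)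
  have ud: "u \<in> dual_space c0_scale"
    using u weak_star_closure_subset_dual_space by blast
  obtain y where y: "norm y \<le> 1" "norm u - d < norm (blinfun_apply u y)"
    using norm_blinfun_almost_attained[OF \<open>0 < d\<close>] .
  have "(\<lambda>N. norm (blinfun_apply u (c0_truncate N y))) \<longlonglongrightarrow> norm (blinfun_apply u y)"
    by (intro tendsto_intros c0_truncate_tendsto)
  from order_tendstoD(1)[OF this y(2)]
  obtain N where N: "norm u - d < norm (blinfun_apply u (c0_truncate N y))"
    by (auto simp: eventually_sequentially)
  \<comment> \<open>Errors on \<open>N\<close> unit vectors add up to at most \<open>d\<close>; the
    denominator \<open>real N + 1\<close> also covers \<open>N = 0\<close>.\<close>
  have pos: "0 < d / (real N + 1)" using \<open>0 < d\<close> by simp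
  obtain v where v: "v \<in> A"
    "\<And>x. x \<in> c0_unit ` {..<N} \<Longrightarrow> norm (blinfun_apply v x - blinfun_apply u x) < d / (real N + 1)"
    using weak_star_closure_approx[OF u finite_imageI[OF finite_lessThan] pos, of c0_unit N] by blast
  have vd: "v \<in> dual_space c0_scale" and nv: "norm v \<le> norm u"
    using v(1) A by auto
  have head: "norm (blinfun_apply (v - u) (c0_truncate N g)) \<le> d" if "norm g \<le> 1" for g
  proof -
    have "norm (blinfun_apply (v - u) (c0_truncate N g)) \<le> real N * (d / (real N + 1))"
      using v(2) that d.subspace_diff[OF subspace_dual_space vd ud]
      by (intro c0_truncate_apply_le) (auto simp: blinfun.diff_left intro: less_imp_le)
    also have "\<dots> \<le> d" using \<open>0 < d\<close> by (simp add: field_simps)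
    finally show ?thesis .
  qed
  have "norm (v - u) \<le> 4 * d"
  proof (rule norm_blinfun_le_unit_ball)
    fix g :: "'k c0" assume g: "norm g \<le> 1"
    let ?h = "g - c0_truncate N g"
    \<comment> \<open>The head of \<open>y\<close> norms \<open>u\<close> up to \<open>d\<close>,
      hence \<open>v\<close> has modulus above \<open>norm u - 2 * d\<close> there. As
      \<open>norm v\<close> is at most \<open>norm u\<close>, the disjoint support inequality bounds
      both tails.\<close>
    have "norm (blinfun_apply u (c0_truncate N y)) - norm (blinfun_apply v (c0_truncate N y)) \<le> d"
      using head[OF y(1)] norm_triangle_ineq3[of "blinfun_apply v (c0_truncate N y)"
          "blinfun_apply u (c0_truncate N y)"] by (simp add: blinfun.diff_left)
    then have "norm (blinfun_apply u ?h) \<le> d" "norm (blinfun_apply v ?h) \<le> 2 * d"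
      using N nv c0_dual_disjoint_support[OF ud y(1) g, of N]
        c0_dual_disjoint_support[OF vd y(1) g, of N] by auto
    moreover have "blinfun_apply (v - u) g
        = blinfun_apply (v - u) (c0_truncate N g) + (blinfun_apply v ?h - blinfun_apply u ?h)"
      by (simp add: blinfun.bilinear_simps)
    then have "norm (blinfun_apply (v - u) g) \<le> norm (blinfun_apply (v - u) (c0_truncate N g))
        + (norm (blinfun_apply v ?h) + norm (blinfun_apply u ?h))"
      by (simp add: norm_triangle_mono norm_triangle_ineq4)
    ultimately show "norm (blinfun_apply (v - u) g) \<le> 4 * d"
      using head[OF g] by linarith
  qed
  then show "\<exists>v\<in>A. dist v u < e"
    using v(1) \<open>0 < e\<close> by (intro bexI[of _ v]) (auto simp: dist_norm d_def)
qed

theorem corollary4p9: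
  fixes sX :: "'k::real_or_complex \<Rightarrow> 'x::banach \<Rightarrow> 'x"
    and sY :: "'k \<Rightarrow> 'y::banach \<Rightarrow> 'y"
  assumes "banach_space_over sX"
  shows "(banach_space_over sY \<and> locally_uniformly_rotund (dual_space sY)
            \<longrightarrow> QNA sX sY = weak_star_QNA sX sY)
       \<and> QNA sX (c0_scale :: 'k \<Rightarrow> 'k c0 \<Rightarrow> 'k c0) = weak_star_QNA sX c0_scale"
  by (intro conjI impI QNA_eq_weak_star_QNA weak_star_closure_imp_closure_c0
      banach_space_over.weak_star_closure_imp_closure_rotund) auto

end
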